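(* Let $\mathcal{H}$ be a real or complex Hilbert space and let $\mathcal{W}=\{(W_i,v_i)\}_{i\in I}$ and $\mathcal{V}=\{(V_i,v_i)\}_{i\in I}$ be unitary equivalent fusion frames for $\mathcal{H}$ (with the same family of weights $\{v_i\}_{i\in I}$). Then $e(\mathcal{W})=e(\mathcal{V})$.
   Context: A fusion frame for $\mathcal{H}$ is a countable family $\{(W_i,v_i)\}_{i\in I}$ of closed subspaces $W_i\subseteq\mathcal{H}$ with weights $v_i>0$ for which there are constants $0<A\le B<\infty$ with $A\|x\|^2\le\sum_{i\in I}v_i^2\|P_{W_i}(x)\|^2\le B\|x\|^2$ for all $x\in\mathcal{H}$, where $P_{W_i}$ is the orthogonal projection onto $W_i$. Its synthesis operator is $T_{\mathcal{W}}:\big(\sum_{i\in I}\oplus W_i\big)_{\ell_2}\to\mathcal{H}$, $T_{\mathcal{W}}(\{f_i\}_{i\in I})=\sum_{i\in I}v_if_i$, where $\big(\sum_{i\in I}\oplus W_i\big)_{\ell_2}$ is the Hilbert space of families $\{f_i\}_{i\in I}$ with $f_i\in W_i$ and $\sum_i\|f_i\|^2<\infty$. The excess of $\mathcal{W}$ is $e(\mathcal{W})=\dim\ker T_{\mathcal{W}}$. Two fusion frames $\{W_i\}_{i\in I}$ and $\{V_i\}_{i\in I}$ with respect to the same family of weights are unitary equivalent if there exists a unitary operator $U$ on $\mathcal{H}$ such that $W_i=U(V_i)$ for all $i\in I$. *)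

theory Defs
  imports "HOL-Analysis.Analysis"
begin

unbundle cardinal_syntax

text \<open>
  Scalar fields that are either the reals or the complex numbers. In the last axiom, the case
  \<open>j = 0\<close> forces the field to be (a copy of) the reals and the case \<open>j * j = - 1\<close>
  forces it to be (a copy of) the complex numbers; the axiom on \<open>x * kcnj x\<close> then makes
  \<open>kcnj\<close> the identity and the complex conjugation, respectively.
\<close>

class rc_field = real_normed_field + banach +
  fixes kcnj :: "'a \<Rightarrow> 'a"
  assumes kcnj_add: "kcnj (x + y) = kcnj x + kcnj y"
    and kcnj_mult: "kcnj (x * y) = kcnj x * kcnj y"
    and mult_kcnj: "x * kcnj x = (norm x)\<^sup>2 *\<^sub>R 1"
    and real_or_complex:
      "\<exists>j. (j = 0 \<or> j * j = - 1) \<and> (\<forall>z. \<exists>a b. z = a *\<^sub>R 1 + b *\<^sub>R j)"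

instantiation real :: rc_field
begin

definition kcnj_real :: "real \<Rightarrow> real" where "kcnj_real x = x"

instance
proof
  show "\<exists>j::real. (j = 0 \<or> j * j = - 1) \<and> (\<forall>z. \<exists>a b. z = a *\<^sub>R 1 + b *\<^sub>R j)"
    by (intro exI[of _ 0]) auto
qed (simp_all add: kcnj_real_def power2_eq_square)

end

instantiation complex :: rc_field
begin

definition kcnj_complex :: "complex \<Rightarrow> complex" where "kcnj_complex = cnj"

instance
proof
  show "\<exists>j::complex. (j = 0 \<or> j * j = - 1) \<and> (\<forall>z. \<exists>a b. z = a *\<^sub>R 1 + b *\<^sub>R j)"
    by (intro exI[of _ \<i>] conjI allI) (auto simp: complex_eq_iff)
qed (simp_all add: kcnj_complex_def complex_norm_square[symmetric] scaleR_conv_of_real)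

end

text \<open>
  Hilbert spaces over such a field. Norm, topology and completeness are those of the type class
  \<open>banach\<close>; the inner product is linear in its first argument. Positivity and
  definiteness of the inner product follow from the last axiom.
\<close>

locale hilbert_space = vector_space smul
  for smul :: "'k::rc_field \<Rightarrow> 'h::banach \<Rightarrow> 'h" +
  fixes ip :: "'h \<Rightarrow> 'h \<Rightarrow> 'k"
  assumes scale_of_real: "smul (of_real r) x = r *\<^sub>R x"
    and ip_commute: "ip x y = kcnj (ip y x)"
    and ip_add_left: "ip (x + y) z = ip x z + ip y z"
    and ip_scale_left: "ip (smul c x) y = c * ip x y"
    and ip_self: "ip x x = of_real ((norm x)\<^sup>2)"

lemma hilbert_space_real_inner:
  "hilbert_space scaleR (inner :: 'h::{real_inner,banach} \<Rightarrow> 'h \<Rightarrow> real)"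
  by unfold_locales
    (simp_all add: kcnj_real_def inner_commute inner_add_left power2_norm_eq_inner algebra_simps)

lemma hilbert_space_complex: "hilbert_space (*) (\<lambda>x y :: complex. x * cnj y)"
  by unfold_locales
    (simp_all add: kcnj_complex_def scaleR_conv_of_real complex_norm_square[symmetric] algebra_simps
      del: of_real_power)

definition orth_proj :: "('h \<Rightarrow> 'h \<Rightarrow> 'k::zero) \<Rightarrow> 'h::minus set \<Rightarrow> 'h \<Rightarrow> 'h" where
  "orth_proj ip W x = (THE y. y \<in> W \<and> (\<forall>w\<in>W. ip (x - y) w = 0))"

text \<open>
  The sum of squares is required to be summable because \<open>infsum\<close> of a non-summable family is 0.
\<close>

definition fusion_frame ::
  "('k::rc_field \<Rightarrow> 'h::banach \<Rightarrow> 'h) \<Rightarrow> ('h \<Rightarrow> 'h \<Rightarrow> 'k) \<Rightarrow>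
    'i set \<Rightarrow> ('i \<Rightarrow> 'h set) \<Rightarrow> ('i \<Rightarrow> real) \<Rightarrow> bool" where
  "fusion_frame smul ip I W v \<longleftrightarrow>
     countable I \<and>
     (\<forall>i\<in>I. module.subspace smul (W i) \<and> closed (W i) \<and> v i > 0) \<and>
     (\<exists>A B. 0 < A \<and> A \<le> B \<and>
       (\<forall>x. (\<lambda>i. (v i)\<^sup>2 * (norm (orth_proj ip (W i) x))\<^sup>2) summable_on I \<and>
            A * (norm x)\<^sup>2 \<le> (\<Sum>\<^sub>\<infinity>i\<in>I. (v i)\<^sup>2 * (norm (orth_proj ip (W i) x))\<^sup>2) \<and>
            (\<Sum>\<^sub>\<infinity>i\<in>I. (v i)\<^sup>2 * (norm (orth_proj ip (W i) x))\<^sup>2) \<le> B * (norm x)\<^sup>2))"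

text \<open>
  A family indexed by \<open>I\<close> is represented by the function that extends it by 0 outside \<open>I\<close>.
\<close>

definition l2_sum :: "'i set \<Rightarrow> ('i \<Rightarrow> 'h::real_normed_vector set) \<Rightarrow> ('i \<Rightarrow> 'h) set" where
  "l2_sum I W =
     {f. (\<forall>i\<in>I. f i \<in> W i) \<and> (\<forall>i. i \<notin> I \<longrightarrow> f i = 0) \<and> (\<lambda>i. (norm (f i))\<^sup>2) summable_on I}"

definition l2_ip ::
  "('h \<Rightarrow> 'h \<Rightarrow> 'k::rc_field) \<Rightarrow> 'i set \<Rightarrow> ('i \<Rightarrow> 'h) \<Rightarrow> ('i \<Rightarrow> 'h) \<Rightarrow> 'k" where
  "l2_ip ip I f g = (\<Sum>\<^sub>\<infinity>i\<in>I. ip (f i) (g i))"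

text \<open>For a fusion frame this sum converges unconditionally for every member of \<open>l2_sum I W\<close>.\<close>

definition synthesis :: "'i set \<Rightarrow> ('i \<Rightarrow> real) \<Rightarrow> ('i \<Rightarrow> 'h::banach) \<Rightarrow> 'h" where
  "synthesis I v f = (\<Sum>\<^sub>\<infinity>i\<in>I. v i *\<^sub>R f i)"

definition synthesis_kernel ::
  "'i set \<Rightarrow> ('i \<Rightarrow> 'h::banach set) \<Rightarrow> ('i \<Rightarrow> real) \<Rightarrow> ('i \<Rightarrow> 'h) set" where
  "synthesis_kernel I W v = {f \<in> l2_sum I W. synthesis I v f = 0}"

definition orthonormal :: "('a \<Rightarrow> 'a \<Rightarrow> 'k::zero_neq_one) \<Rightarrow> 'a set \<Rightarrow> bool" where
  "orthonormal ip B \<longleftrightarrow> (\<forall>x\<in>B. \<forall>y\<in>B. ip x y = (if x = y then 1 else 0))"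

text \<open>An orthonormal basis of a Hilbert space is a maximal orthonormal subset.\<close>

definition orthonormal_basis ::
  "('a \<Rightarrow> 'a \<Rightarrow> 'k::zero_neq_one) \<Rightarrow> 'a set \<Rightarrow> 'a set \<Rightarrow> bool" where
  "orthonormal_basis ip K B \<longleftrightarrow>
     B \<subseteq> K \<and> orthonormal ip B \<and>
     (\<forall>B'. B' \<subseteq> K \<and> orthonormal ip B' \<and> B \<subseteq> B' \<longrightarrow> B' = B)"

text \<open>
  The dimension of a Hilbert space is the cardinality of any of its orthonormal bases, here a
  cardinal in the sense of the library (a well-order relation, unique only up to \<open>=o\<close>), so that
  infinite dimensions are distinguished.
\<close>

definition hilbert_dim :: "('a \<Rightarrow> 'a \<Rightarrow> 'k::zero_neq_one) \<Rightarrow> 'a set \<Rightarrow> 'a rel" where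
  "hilbert_dim ip K = |SOME B. orthonormal_basis ip K B|"

definition excess ::
  "('h \<Rightarrow> 'h \<Rightarrow> 'k::rc_field) \<Rightarrow> 'i set \<Rightarrow> ('i \<Rightarrow> 'h::banach set) \<Rightarrow> ('i \<Rightarrow> real) \<Rightarrow>
    ('i \<Rightarrow> 'h) rel" where
  "excess ip I W v = hilbert_dim (l2_ip ip I) (synthesis_kernel I W v)"

definition unitary ::
  "('k::rc_field \<Rightarrow> 'h::banach \<Rightarrow> 'h) \<Rightarrow> ('h \<Rightarrow> 'h \<Rightarrow> 'k) \<Rightarrow> ('h \<Rightarrow> 'h) \<Rightarrow> bool" where
  "unitary smul ip U \<longleftrightarrow>
     Vector_Spaces.linear smul smul U \<and> surj U \<and> (\<forall>x y. ip (U x) (U y) = ip x y)"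

definition unitary_equivalent ::
  "('k::rc_field \<Rightarrow> 'h::banach \<Rightarrow> 'h) \<Rightarrow> ('h \<Rightarrow> 'h \<Rightarrow> 'k) \<Rightarrow>
    'i set \<Rightarrow> ('i \<Rightarrow> 'h set) \<Rightarrow> ('i \<Rightarrow> 'h set) \<Rightarrow> bool" where
  "unitary_equivalent smul ip I W V \<longleftrightarrow>
     (\<exists>U. unitary smul ip U \<and> (\<forall>i\<in>I. W i = U ` V i))"

end

(* A unitary U with W i = U (V i) acts componentwise as an isometric bijection between the two
   synthesis kernels, so it carries orthonormal bases to orthonormal bases. What remains is that the
   excess does not depend on the chosen basis. If B is a maximal orthonormal set of an inner product
   space and C another one, then every c in C is non-orthogonal to some
   b in B, and by Bessel each b meets only countably many c in this way; this gives |C| <= |B| for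
   infinite B. For finite B, Parseval turns |C| into the sum of |<b,c>|^2 over B and C, which Bessel
   bounds by |B|. The kernel is a linear subspace because v_i f_i is summable for every member of
   the l2 sum, which follows from |sum v_i f_i|^2 <= D sum |f_i|^2, D being the
   upper frame bound. *)

theory Submission
  imports Defs "HOL-Library.Function_Algebras" "HOL-Library.Countable_Set_Type"
begin

section \<open>Conjugation on the scalar field\<close>

lemma kcnj_0 [simp]: "kcnj (0::'k::rc_field) = 0"
  using kcnj_add[of "0::'k" 0] by simp

lemma kcnj_of_real [simp]: "kcnj (of_real r :: 'k::rc_field) = of_real r"
proof (cases "r = 0")
  case False
  have "(of_real r :: 'k) * kcnj (of_real r) = of_real r * of_real r"
    by (subst mult_kcnj) (simp add: scaleR_conv_of_real power2_eq_square flip: of_real_mult)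
  with False show ?thesis by simp
qed simp

text \<open>Taking norms in \<open>mult_kcnj\<close> leaves a common factor \<open>norm x\<close> on
  both sides, which cancels unless \<open>x\<close> is zero.\<close>

lemma norm_kcnj [simp]: "norm (kcnj (x::'k::rc_field)) = norm x"
proof (cases "x = 0")
  case False
  have "norm x * norm (kcnj x) = (norm x)\<^sup>2"
    using arg_cong[OF mult_kcnj[of x], of norm] by (simp add: norm_mult)
  with False show ?thesis by (simp add: power2_eq_square)
qed simp

lemma kcnj_eq_0_iff [simp]: "kcnj (x::'k::rc_field) = 0 \<longleftrightarrow> x = 0"
  using norm_kcnj[of x] by (metis norm_eq_zero)

lemma kcnj_scaleR: "kcnj (r *\<^sub>R x :: 'k::rc_field) = r *\<^sub>R kcnj x"
  by (simp add: scaleR_conv_of_real kcnj_mult)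

text \<open>Boundedness lets conjugation pass through the infinite sum in \<open>l2_ip\<close>,
  which yields the conjugate symmetry of that form.\<close>

lemma bounded_linear_kcnj: "bounded_linear (kcnj :: 'k::rc_field \<Rightarrow> 'k)"
  by (rule bounded_linear_intro[where K = 1]) (simp_all add: kcnj_add kcnj_scaleR)

section \<open>Inner product subspaces: Bessel, Parseval and the cardinality of bases\<close>

text \<open>Serves both the Hilbert space itself and the synthesis kernel. The laws are relative to
  \<open>K\<close> because \<open>l2_ip\<close> obeys them only where its sums converge. The squared
  norm is a parameter because the function type holding the kernel does not carry the l2 norm as its
  class norm.\<close>

locale inner_product_subspace = vector_space smul
  for smul :: "'k::rc_field \<Rightarrow> 'v::ab_group_add \<Rightarrow> 'v" +
  fixes ip :: "'v \<Rightarrow> 'v \<Rightarrow> 'k" and K :: "'v set" and normsq :: "'v \<Rightarrow> real"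
  assumes subspace_K: "subspace K"
    and commute: "x \<in> K \<Longrightarrow> y \<in> K \<Longrightarrow> ip x y = kcnj (ip y x)"
    and add_left: "x \<in> K \<Longrightarrow> y \<in> K \<Longrightarrow> z \<in> K \<Longrightarrow> ip (x + y) z = ip x z + ip y z"
    and scale_left: "x \<in> K \<Longrightarrow> y \<in> K \<Longrightarrow> ip (smul c x) y = c * ip x y"
    and self: "x \<in> K \<Longrightarrow> ip x x = of_real (normsq x)"
    and normsq_nonneg: "x \<in> K \<Longrightarrow> 0 \<le> normsq x"
    and normsq_eq_0D: "x \<in> K \<Longrightarrow> normsq x = 0 \<Longrightarrow> x = 0"
begin

lemma zero_left: "y \<in> K \<Longrightarrow> ip 0 y = 0"
  using scale_left[of y y 0] by simp

lemma diff_left: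
  assumes "x \<in> K" "y \<in> K" "z \<in> K"
  shows "ip (x - y) z = ip x z - ip y z"
  using add_left[of "x - y" y z] assms subspace_diff[OF subspace_K] by simp

lemma scale_right: "x \<in> K \<Longrightarrow> y \<in> K \<Longrightarrow> ip x (smul c y) = kcnj c * ip x y"
  using commute[of x "smul c y"] scale_left[of y x c] commute[of x y] subspace_scale[OF subspace_K]
  by (simp add: kcnj_mult)

lemma add_right:
  "x \<in> K \<Longrightarrow> y \<in> K \<Longrightarrow> z \<in> K \<Longrightarrow> ip x (y + z) = ip x y + ip x z"
  using commute[of x "y + z"] add_left[of y z x] commute[of x y] commute[of x z]
    subspace_add[OF subspace_K] by (simp add: kcnj_add)

lemma diff_right:
  "x \<in> K \<Longrightarrow> y \<in> K \<Longrightarrow> z \<in> K \<Longrightarrow> ip x (y - z) = ip x y - ip x z"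
  using add_right[of x "y - z" z] subspace_diff[OF subspace_K] by simp

lemma sum_left:
  assumes "\<And>a. a \<in> A \<Longrightarrow> f a \<in> K" "y \<in> K"
  shows "ip (sum f A) y = (\<Sum>a\<in>A. ip (f a) y)"
  using assms
proof (induction A rule: infinite_finite_induct)
  case (insert a A)
  then show ?case by (simp add: add_left subspace_sum[OF subspace_K])
qed (simp_all add: zero_left)

lemma norm_ip_mult_self:
  assumes "x \<in> K" "y \<in> K"
  shows "ip x y * ip y x = of_real ((norm (ip x y))\<^sup>2)"
  using mult_kcnj[of "ip x y"] commute[of y x] assms by (simp add: scaleR_conv_of_real)

text \<open>The subtracted sum \<open>p\<close> is the projection of \<open>x\<close> onto the span
  of \<open>F\<close>. Since \<open>r\<close> is orthogonal to each member of \<open>F\<close>, it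
  is orthogonal to \<open>p\<close>, and the last claim is Pythagoras for
  \<open>x = r + p\<close>.\<close>

lemma Bessel_residual:
  assumes F: "finite F" "F \<subseteq> K" "orthonormal ip F" and x: "x \<in> K"
  defines "r \<equiv> x - (\<Sum>e\<in>F. smul (ip x e) e)"
  shows "r \<in> K" and "\<And>e. e \<in> F \<Longrightarrow> ip r e = 0"
    and "normsq x = normsq r + (\<Sum>e\<in>F. (norm (ip x e))\<^sup>2)"
proof -
  define p where "p = (\<Sum>e\<in>F. smul (ip x e) e)"
  have sK: "smul c e \<in> K" if "e \<in> F" for c e
    using that F(2) subspace_scale[OF subspace_K] by blast
  have p: "p \<in> K" unfolding p_def by (intro subspace_sum[OF subspace_K] sK)
  show r: "r \<in> K" using subspace_diff[OF subspace_K x p] by (simp add: r_def p_def)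
  have ip_p: "ip p y = (\<Sum>e\<in>F. ip x e * ip e y)" if "y \<in> K" for y
    unfolding p_def using F(2) that sK
    by (subst sum_left) (auto intro!: sum.cong scale_left)
  show re: "ip r e = 0" if e: "e \<in> F" for e
  proof -
    have "ip p e = (\<Sum>e'\<in>F. if e' = e then ip x e' else 0)"
      using e F(2,3) by (subst ip_p) (auto simp: orthonormal_def intro!: sum.cong)
    also have "\<dots> = ip x e" using e F(1) by simp
    finally show ?thesis
      using e F(2) x p by (simp add: r_def flip: p_def) (subst diff_left, auto)
  qed
  have "ip p r = 0"
    using F(2) re r by (subst ip_p) (auto intro!: sum.neutral simp: commute[of _ r] subset_iff)
  then have "ip r p = 0" using commute[OF r p] by simp
  have xr: "x = r + p" by (simp add: r_def p_def)
  have "ip x r = ip r r" using r p xr add_left[of r p r] \<open>ip p r = 0\<close> by simp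
  then have "ip r x = ip r r"
    using commute[of r x] commute[of r r] r x by simp
  moreover have "ip p x = of_real (\<Sum>e\<in>F. (norm (ip x e))\<^sup>2)"
    using F(2) x by (subst ip_p) (auto intro!: sum.cong norm_ip_mult_self simp del: of_real_power)
  moreover have "ip x x = ip r x + ip p x" using add_left[OF r p x] xr by simp
  ultimately have "(of_real (normsq x) :: 'k) = of_real (normsq r + (\<Sum>e\<in>F. (norm (ip x e))\<^sup>2))"
    using self[OF x] self[OF r] by simp
  then show "normsq x = normsq r + (\<Sum>e\<in>F. (norm (ip x e))\<^sup>2)" unfolding of_real_eq_iff .
qed

lemma Bessel_inequality:
  assumes "finite F" "F \<subseteq> K" "orthonormal ip F" "x \<in> K"
  shows "(\<Sum>e\<in>F. (norm (ip x e))\<^sup>2) \<le> normsq x"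
  using Bessel_residual[OF assms] normsq_nonneg by fastforce

lemma normsq_scale: 
  assumes "x \<in> K"
  shows "normsq (smul c x) = (norm c)\<^sup>2 * normsq x"
proof -
  have "ip (smul c x) (smul c x) = c * kcnj c * ip x x"
    using assms by (simp add: scale_left scale_right subspace_scale[OF subspace_K])
  then have "(of_real (normsq (smul c x)) :: 'k) = of_real ((norm c)\<^sup>2 * normsq x)"
    using assms self subspace_scale[OF subspace_K]
    by (simp add: mult_kcnj scaleR_conv_of_real)
  then show ?thesis unfolding of_real_eq_iff .
qed

lemma normalize:
  assumes "x \<in> K" "x \<noteq> 0"
  obtains c where "c \<noteq> 0" "ip (smul c x) (smul c x) = 1"
proof
  have pos: "normsq x > 0" using assms normsq_nonneg normsq_eq_0D by fastforce
  let ?c = "of_real (1 / sqrt (normsq x)) :: 'k"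
  show "?c \<noteq> 0" using pos by simp
  have "normsq (smul ?c x) = 1"
    unfolding normsq_scale[OF assms(1)] norm_of_real using pos by (simp add: power_divide)
  then show "ip (smul ?c x) (smul ?c x) = 1"
    using self[of "smul ?c x"] assms subspace_scale[OF subspace_K] by simp
qed

text \<open>Otherwise \<open>y\<close> could be adjoined to \<open>B\<close>. Maximality then puts
  \<open>y\<close> in \<open>B\<close>, so \<open>y\<close> is orthogonal to itself, against
  \<open>ip y y = 1\<close>.\<close>

lemma orthonormal_basis_not_orthogonal:
  assumes "orthonormal_basis ip K B" "y \<in> K" "ip y y = 1"
  shows "\<exists>e\<in>B. ip y e \<noteq> 0"
proof (rule ccontr)
  assume "\<not> ?thesis"
  then have 0: "ip y e = 0" "ip e y = 0" if "e \<in> B" for e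
    using that assms commute[of e y] by (auto simp: orthonormal_basis_def)
  then have "orthonormal ip (insert y B)"
    using assms by (auto simp: orthonormal_basis_def orthonormal_def)
  then have "insert y B = B"
    using assms unfolding orthonormal_basis_def by blast
  then show False using 0[of y] assms(3) by auto
qed

text \<open>The Bessel residual is orthogonal to all of \<open>B\<close>; were it nonzero, its
  normalization would contradict maximality. So the residual vanishes and Bessel becomes an
  equality.\<close>

lemma finite_basis_Parseval:
  assumes B: "orthonormal_basis ip K B" "finite B" and x: "x \<in> K"
  shows "(\<Sum>e\<in>B. (norm (ip x e))\<^sup>2) = normsq x"
proof -
  have BK: "B \<subseteq> K" "orthonormal ip B" using B by (auto simp: orthonormal_basis_def)
  define r where "r = x - (\<Sum>e\<in>B. smul (ip x e) e)"
  note res = Bessel_residual[OF B(2) BK x, folded r_def]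
  have "r = 0"
  proof (rule ccontr)
    assume "r \<noteq> 0"
    then obtain c where c: "ip (smul c r) (smul c r) = 1" using normalize res(1) by blast
    obtain e where "e \<in> B" "ip (smul c r) e \<noteq> 0"
      using orthonormal_basis_not_orthogonal[OF B(1) subspace_scale[OF subspace_K res(1)] c] by blast
    then show False using res(1,2) BK(1) by (auto simp: scale_left subset_iff)
  qed
  then have "normsq r = 0"
    using self[of 0] zero_left[of 0] subspace_0[OF subspace_K] by simp
  then show ?thesis using res(3) by simp
qed

text \<open>Bessel bounds every finite partial sum by \<open>normsq x\<close>, so the squared
  coefficients are summable, and a summable family has countable support.\<close>

lemma countable_ip_nonzero:
  assumes "B \<subseteq> K" "orthonormal ip B" "x \<in> K"
  shows "countable {e\<in>B. ip x e \<noteq> 0}"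
proof -
  have "(\<lambda>e. (norm (ip x e))\<^sup>2) summable_on B"
  proof (rule nonneg_bdd_above_summable_on)
    show "bdd_above (sum (\<lambda>e. (norm (ip x e))\<^sup>2) ` {F. F \<subseteq> B \<and> finite F})"
    proof (rule bdd_aboveI2)
      fix F assume "F \<in> {F. F \<subseteq> B \<and> finite F}"
      then show "(\<Sum>e\<in>F. (norm (ip x e))\<^sup>2) \<le> normsq x"
        using assms by (intro Bessel_inequality) (auto simp: orthonormal_def subset_iff)
    qed
  qed simp
  then have "countable {e\<in>B. (norm (ip x e))\<^sup>2 \<noteq> 0}"
    by (intro abs_summable_countable) simp
  then show ?thesis by simp
qed

lemma orthonormal_basis_card_le:
  assumes B: "orthonormal_basis ip K B" and C: "orthonormal_basis ip K C"
  shows "|C| \<le>o |B|"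
proof -
  have BK: "B \<subseteq> K" "orthonormal ip B" and CK: "C \<subseteq> K" "orthonormal ip C"
    using B C by (auto simp: orthonormal_basis_def)
  show ?thesis
  proof (cases "finite B")
    case True
    \<comment> \<open>Finiteness of \<open>C\<close> is not known in advance and Bessel applies to
      finite sets, so finite subsets of \<open>C\<close> are bounded uniformly.\<close>
    have "card F \<le> card B" if F: "F \<subseteq> C" "finite F" for F
    proof -
      have FK: "F \<subseteq> K" "orthonormal ip F"
        using F CK by (auto simp: orthonormal_def subset_iff)
      have one: "normsq e = 1" if "e \<in> B \<union> F" for e
        using that self[of e] BK FK by (auto simp: orthonormal_def subset_iff)
      have "real (card F) = (\<Sum>y\<in>F. normsq y)" using one by simp
      \<comment> \<open>Double counting: Parseval in \<open>B\<close> expands each unit vector of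
        \<open>F\<close>; after the sums are swapped, Bessel in \<open>F\<close> bounds the inner
        sum for each \<open>e\<close> in \<open>B\<close>.\<close>
      also have "\<dots> = (\<Sum>y\<in>F. \<Sum>e\<in>B. (norm (ip y e))\<^sup>2)"
        using finite_basis_Parseval[OF B True] FK by (intro sum.cong) auto
      also have "\<dots> = (\<Sum>e\<in>B. \<Sum>y\<in>F. (norm (ip e y))\<^sup>2)"
      proof (subst sum.swap, intro sum.cong refl)
        fix e y assume "e \<in> B" "y \<in> F"
        then have "ip y e = kcnj (ip e y)" using commute BK(1) FK(1) by blast
        then show "(norm (ip y e))\<^sup>2 = (norm (ip e y))\<^sup>2" by simp
      qed
      also have "\<dots> \<le> (\<Sum>e\<in>B. normsq e)"
        using BK FK F by (intro sum_mono Bessel_inequality) auto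
      also have "\<dots> = card B" using one by simp
      finally show ?thesis by simp
    qed
    then have "finite C \<and> card C \<le> card B" by (intro finite_if_finite_subsets_card_bdd)
    then show ?thesis using True inj_on_iff_card_le[of C B] by (simp flip: card_of_ordLeq)
  next
    case False
    \<comment> \<open>Each unit vector \<open>c\<close> meets some \<open>b\<close>
      non-orthogonally, so \<open>C\<close> is covered by a \<open>B\<close>-indexed family of
      countable sets; as \<open>B\<close> is infinite, the union is no larger than
      \<open>B\<close>.\<close>
    have "C = (\<Union>b\<in>B. {c\<in>C. ip b c \<noteq> 0})"
    proof (intro equalityI subsetI)
      fix c assume c: "c \<in> C"
      then obtain b where "b \<in> B" "ip c b \<noteq> 0"
        using orthonormal_basis_not_orthogonal[OF B, of c] CK by (auto simp: orthonormal_def)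
      moreover have "ip c b = kcnj (ip b c)"
        using c \<open>b \<in> B\<close> CK(1) BK(1) by (intro commute) auto
      ultimately show "c \<in> (\<Union>b\<in>B. {c\<in>C. ip b c \<noteq> 0})" using c by auto
    qed auto
    moreover have "|\<Union>b\<in>B. {c\<in>C. ip b c \<noteq> 0}| \<le>o |B|"
    proof (intro card_of_UNION_ordLeq_infinite[OF False] ballI)
      fix b assume "b \<in> B"
      then have "countable {c\<in>C. ip b c \<noteq> 0}"
        using BK CK by (intro countable_ip_nonzero) auto
      then show "|{c\<in>C. ip b c \<noteq> 0}| \<le>o |B|"
        using False by (meson countable_card_of_nat infinite_iff_card_of_nat ordLeq_transitive)
    qed (simp add: card_of_mono1)
    ultimately show ?thesis by simp
  qed
qed

lemma orthonormal_basis_card_eq: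
  "orthonormal_basis ip K B \<Longrightarrow> orthonormal_basis ip K C \<Longrightarrow> |B| =o |C|"
  by (simp add: ordIso_iff_ordLeq orthonormal_basis_card_le)

text \<open>This is Bessel for the single unit vector obtained by normalizing
  \<open>y\<close>.\<close>

lemma Cauchy_Schwarz:
  assumes x: "x \<in> K" and y: "y \<in> K"
  shows "(norm (ip x y))\<^sup>2 \<le> normsq x * normsq y"
proof (cases "y = 0")
  case True
  then have "ip x y = 0" using zero_left[OF x] commute[OF x y] by simp
  then show ?thesis using normsq_nonneg x y by simp
next
  case False
  then obtain c where c: "c \<noteq> 0" "ip (smul c y) (smul c y) = 1" using normalize y by blast
  have cy: "smul c y \<in> K" using subspace_scale[OF subspace_K y] .
  have "(of_real ((norm c)\<^sup>2 * normsq y) :: 'k) = 1"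
    using c(2) self[OF cy] normsq_scale[OF y] by simp
  then have 1: "(norm c)\<^sup>2 * normsq y = 1" by (simp only: of_real_eq_1_iff)
  have "(\<Sum>e\<in>{smul c y}. (norm (ip x e))\<^sup>2) \<le> normsq x"
    using c cy x by (intro Bessel_inequality) (auto simp: orthonormal_def)
  then have "(norm c)\<^sup>2 * (norm (ip x y))\<^sup>2 \<le> normsq x"
    using x y by (simp add: scale_right norm_mult power_mult_distrib)
  then have "((norm c)\<^sup>2 * (norm (ip x y))\<^sup>2) * normsq y \<le> normsq x * normsq y"
    using normsq_nonneg[OF y] by (rule mult_right_mono)
  moreover have "((norm c)\<^sup>2 * (norm (ip x y))\<^sup>2) * normsq y
      = (norm (ip x y))\<^sup>2 * ((norm c)\<^sup>2 * normsq y)" by (simp add: mult_ac)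
  ultimately show ?thesis using 1 by simp
qed

end

section \<open>Orthonormal bases under isometric bijections\<close>

text \<open>Orthonormality is expressed by inner products and equality alone, both of which \<phi>
  preserves and reflects on \<open>K\<close>. An orthonormal extension of the image therefore pulls
  back to one of \<open>B\<close>, where maximality applies.\<close>

lemma orthonormal_basis_image:
  assumes bij: "bij_betw \<phi> K L"
    and ip: "\<And>x y. x \<in> K \<Longrightarrow> y \<in> K \<Longrightarrow> ip (\<phi> x) (\<phi> y) = ip x y"
    and B: "orthonormal_basis ip K B"
  shows "orthonormal_basis ip L (\<phi> ` B)"
  unfolding orthonormal_basis_def
proof (intro conjI allI impI)
  have inj: "inj_on \<phi> K" and img: "\<phi> ` K = L" using bij by (auto simp: bij_betw_def)
  have BK: "B \<subseteq> K" "orthonormal ip B"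
    and max: "\<And>B'. B' \<subseteq> K \<Longrightarrow> orthonormal ip B' \<Longrightarrow> B \<subseteq> B' \<Longrightarrow> B' = B"
    using B by (auto simp: orthonormal_basis_def)
  have orth: "orthonormal ip (\<phi> ` C) \<longleftrightarrow> orthonormal ip C" if "C \<subseteq> K" for C
    using that inj ip by (simp add: orthonormal_def subset_iff inj_on_eq_iff)
  show "\<phi> ` B \<subseteq> L" using BK img by blast
  show "orthonormal ip (\<phi> ` B)" using orth BK by blast
  fix B' assume B': "B' \<subseteq> L \<and> orthonormal ip B' \<and> \<phi> ` B \<subseteq> B'"
  define C where "C = {x\<in>K. \<phi> x \<in> B'}"
  have C: "\<phi> ` C = B'" using B' img by (auto simp: C_def)
  have "C = B"
    using B' BK(1) orth[of C] C by (intro max) (auto simp: C_def)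
  with C show "B' = \<phi> ` B" by simp
qed

section \<open>Unordered sums in Banach spaces\<close>

text \<open>Cauchy criterion for the net of finite partial sums: beyond a suitable finite set the
  tails of \<open>g\<close> are small, hence so are those of \<open>f\<close>, and completeness
  supplies the limit.\<close>

lemma summable_on_dominated_square:
  fixes f :: "'a \<Rightarrow> 'b::banach" and g :: "'a \<Rightarrow> real"
  assumes g: "g summable_on A" "\<And>x. x \<in> A \<Longrightarrow> 0 \<le> g x"
    and le: "\<And>F. finite F \<Longrightarrow> F \<subseteq> A \<Longrightarrow> (norm (sum f F))\<^sup>2 \<le> C * sum g F"
  shows "f summable_on A"
proof -
  have "\<exists>P. eventually P (finite_subsets_at_top A) \<and>
          (\<forall>F F'. P F \<and> P F' \<longrightarrow> dist (sum f F) (sum f F') < e)" if "e > 0" for e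
  proof -
    \<comment> \<open>With \<open>g\<close>-tails of at most \<open>d / 2\<close>, the squared norm
      of an \<open>f\<close>-tail is at most half of \<open>(e / 2)^2\<close>. The denominator
      \<open>\<bar>C\<bar> + 1\<close> is positive whatever the sign of \<open>C\<close>.\<close>
    define d where "d = (e / 2)\<^sup>2 / (\<bar>C\<bar> + 1)"
    have "d > 0" using that by (simp add: d_def)
    then obtain F0 where F0: "finite F0" "F0 \<subseteq> A" "dist (sum g F0) (infsum g A) \<le> d / 2"
      using infsum_finite_approximation[OF g(1), of "d / 2"] by auto
    define P where "P F \<longleftrightarrow> finite F \<and> F0 \<subseteq> F \<and> F \<subseteq> A" for F
    have "dist (sum f F) (sum f F0) < e / 2" if "P F" for F
    proof -
      have F: "finite F" "F0 \<subseteq> F" "F \<subseteq> A" using that by (auto simp: P_def)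
      have "sum g F \<le> infsum g A" using F g by (intro finite_sum_le_infsum) auto
      then have "sum g (F - F0) \<le> d / 2"
        using F F0(1,3) unfolding dist_real_def by (subst sum_diff) linarith+
      moreover have "0 \<le> sum g (F - F0)" using F g by (intro sum_nonneg) auto
      moreover have "(norm (sum f (F - F0)))\<^sup>2 \<le> C * sum g (F - F0)"
        using F by (intro le) auto
      moreover have "C * sum g (F - F0) \<le> (\<bar>C\<bar> + 1) * sum g (F - F0)"
        using \<open>0 \<le> sum g (F - F0)\<close> by (intro mult_right_mono) auto
      moreover have "(\<bar>C\<bar> + 1) * sum g (F - F0) \<le> (\<bar>C\<bar> + 1) * (d / 2)"
        using \<open>sum g (F - F0) \<le> d / 2\<close> by (intro mult_left_mono) auto
      moreover have "(\<bar>C\<bar> + 1) * (d / 2) < (e / 2)\<^sup>2"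
        using \<open>e > 0\<close> by (simp add: d_def field_simps) (simp add: add_pos_nonneg)
      ultimately have "(norm (sum f (F - F0)))\<^sup>2 < (e / 2)\<^sup>2" by linarith
      then have "norm (sum f (F - F0)) < e / 2"
        using \<open>e > 0\<close> by (intro power2_less_imp_less[of _ "e / 2"]) auto
      then show ?thesis using F F0 by (simp add: dist_norm sum_diff)
    qed
    then have "\<forall>F F'. P F \<and> P F' \<longrightarrow> dist (sum f F) (sum f F') < e"
      by (metis dist_triangle_half_l dist_commute)
    moreover have "eventually P (finite_subsets_at_top A)"
      unfolding eventually_finite_subsets_at_top P_def using F0 by blast
    ultimately show ?thesis by blast
  qed
  then have "cauchy_filter (filtermap (sum f) (finite_subsets_at_top A))"
    by (simp add: cauchy_filter_metric_filtermap)
  moreover have "complete (UNIV::'b set)"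
    by (meson Cauchy_convergent UNIV_I complete_def convergent_def)
  ultimately obtain L where "(sum f \<longlongrightarrow> L) (finite_subsets_at_top A)"
    using complete_uniform[where S = UNIV] by (force simp: filterlim_def)
  then show ?thesis
    using summable_on_def has_sum_def by blast
qed

lemma infsum_bounded_linear:
  assumes "bounded_linear h" "f summable_on A"
  shows "(\<Sum>\<^sub>\<infinity>x\<in>A. h (f x)) = h (infsum f A)"
  by (rule infsumI[OF has_sum_bounded_linear[OF assms(1) has_sum_infsum[OF assms(2)]]])

section \<open>Orthogonal projections in a Hilbert space\<close>

context hilbert_space
begin

sublocale whole: inner_product_subspace smul ip UNIV "\<lambda>x. (norm x)\<^sup>2"
proof unfold_locales
  show "subspace UNIV" by (rule subspace_UNIV)
  show "ip x y = kcnj (ip y x)" for x y by (rule ip_commute)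
qed (simp_all add: ip_add_left ip_scale_left ip_self)

lemma norm_ip_le: "norm (ip x y) \<le> norm x * norm y"
  using whole.Cauchy_Schwarz[of x y] unfolding power_mult_distrib[symmetric]
  by (rule power2_le_imp_le) simp_all

text \<open>The type \<open>'h\<close> is only a Banach space, so the law is obtained by expanding
  the inner product \<open>ip\<close> and then removing the embedding of the reals into the
  scalars.\<close>

lemma parallelogram_law:
  fixes x y :: 'h
  shows "(norm (x + y))\<^sup>2 + (norm (x - y))\<^sup>2 = 2 * (norm x)\<^sup>2 + 2 * (norm y)\<^sup>2"
proof -
  have "(of_real ((norm (x + y))\<^sup>2 + (norm (x - y))\<^sup>2) :: 'k) =
      of_real (2 * (norm x)\<^sup>2 + 2 * (norm y)\<^sup>2)"
    unfolding of_real_add of_real_mult ip_self[symmetric]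
    by (simp add: whole.diff_left whole.diff_right whole.add_left whole.add_right
        flip: mult_2 del: of_real_power)
  then show ?thesis unfolding of_real_eq_iff .
qed

lemma subspace_scaleR: "subspace W \<Longrightarrow> x \<in> W \<Longrightarrow> r *\<^sub>R x \<in> W"
  using subspace_scale[of W x "of_real r"] by (simp add: scale_of_real)

text \<open>A minimizing sequence in \<open>W\<close> is Cauchy by the parallelogram law, and its
  limit \<open>y\<close> is a nearest point to \<open>x\<close>. If \<open>x - y\<close> had a
  component along a unit vector of \<open>W\<close>, shifting \<open>y\<close> by that component
  would bring it closer.\<close>

lemma projection_exists:
  assumes W: "subspace W" "closed W"
  shows "\<exists>y\<in>W. \<forall>w\<in>W. ip (x - y) w = 0"
proof -
  define d where "d = (INF w\<in>W. (norm (x - w))\<^sup>2)"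
  have bdd: "bdd_below ((\<lambda>w. (norm (x - w))\<^sup>2) ` W)" by (rule bdd_belowI2[of _ 0]) simp
  have ne: "W \<noteq> {}" using subspace_0[OF W(1)] by auto
  have d: "d \<le> (norm (x - w))\<^sup>2" if "w \<in> W" for w
    unfolding d_def using bdd that by (rule cINF_lower)
  have "\<exists>w\<in>W. (norm (x - w))\<^sup>2 < d + inverse (real (Suc n))" for n
    using cINF_less_iff[OF ne bdd, of "d + inverse (real (Suc n))"] by (simp add: d_def)
  then obtain w where wW: "w n \<in> W" and w: "(norm (x - w n))\<^sup>2 < d + inverse (real (Suc n))" for n
    by metis
  have dist_w: "(dist (w m) (w n))\<^sup>2 < 2 * inverse (real (Suc m)) + 2 * inverse (real (Suc n))" for m n
  proof -
    let ?a = "x - w m" and ?b = "x - w n"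
    \<comment> \<open>The midpoint of two members of \<open>W\<close> is again in \<open>W\<close>,
      so its squared distance to \<open>x\<close> is at least \<open>d\<close>; this bounds the sum
      term in the parallelogram law from below.\<close>
    have "(1/2) *\<^sub>R (w m + w n) \<in> W"
      using subspace_scaleR[OF W(1)] subspace_add[OF W(1)] wW by blast
    then have "d \<le> (norm (x - (1/2) *\<^sub>R (w m + w n)))\<^sup>2" by (rule d)
    also have "x - (1/2) *\<^sub>R (w m + w n) = (1/2) *\<^sub>R (?a + ?b)"
      by (simp add: algebra_simps scaleR_add_left[symmetric])
    finally have "4 * d \<le> (norm (?a + ?b))\<^sup>2" by (simp add: power_divide)
    moreover have "(norm (?a + ?b))\<^sup>2 + (norm (?a - ?b))\<^sup>2 = 2 * (norm ?a)\<^sup>2 + 2 * (norm ?b)\<^sup>2"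
      by (rule parallelogram_law)
    moreover have "norm (?a - ?b) = dist (w m) (w n)" by (simp add: dist_norm norm_minus_commute)
    ultimately show ?thesis using w[of m] w[of n] by simp
  qed
  have "Cauchy w"
  proof (rule metric_CauchyI)
    fix e :: real assume "e > 0"
    \<comment> \<open>The bound \<open>dist_w\<close> has total weight four on the inverses, hence
      the threshold \<open>e\<^sup>2 / 4\<close>.\<close>
    then obtain M where M: "inverse (real (Suc M)) < e\<^sup>2 / 4"
      using reals_Archimedean[of "e\<^sup>2 / 4"] by auto
    have "dist (w m) (w n) < e" if "m \<ge> M" "n \<ge> M" for m n
    proof -
      have le: "inverse (real (Suc k)) \<le> inverse (real (Suc M))" if "k \<ge> M" for k
        using that by (intro le_imp_inverse_le) auto
      then have "(dist (w m) (w n))\<^sup>2 < e\<^sup>2"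
        using dist_w[of m n] M le[OF that(1)] le[OF that(2)] by linarith
      then show ?thesis using \<open>e > 0\<close> by (intro power2_less_imp_less[of _ e]) auto
    qed
    then show "\<exists>M. \<forall>m\<ge>M. \<forall>n\<ge>M. dist (w m) (w n) < e" by blast
  qed
  then obtain y where y: "w \<longlonglongrightarrow> y" using Cauchy_convergent convergent_def by blast
  have yW: "y \<in> W" using closed_sequentially[OF W(2)] wW y by blast
  have "(\<lambda>n. (norm (x - w n))\<^sup>2) \<longlonglongrightarrow> (norm (x - y))\<^sup>2" by (intro tendsto_intros y)
  moreover have "(\<lambda>n. d + inverse (real (Suc n))) \<longlonglongrightarrow> d"
    using tendsto_add[OF tendsto_const LIMSEQ_inverse_real_of_nat] by simp
  ultimately have min: "(norm (x - y))\<^sup>2 \<le> d"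
    by (rule LIMSEQ_le) (meson w less_imp_le)
  have "ip (x - y) u = 0" if u: "u \<in> W" for u
  proof (cases "u = 0")
    case True
    then show ?thesis using whole.scale_right[of "x - y" u 0] by simp
  next
    case False
    then obtain c where c: "c \<noteq> 0" "ip (smul c u) (smul c u) = 1" using whole.normalize by blast
    let ?e = "smul c u"
    \<comment> \<open>Pythagoras for the component of \<open>x - y\<close> along the unit vector
      \<open>?e\<close>. The first summand is the squared distance of \<open>x\<close> from another
      point of \<open>W\<close>, hence at least \<open>d\<close>.\<close>
    have "(norm (x - y))\<^sup>2 = (norm (x - y - smul (ip (x - y) ?e) ?e))\<^sup>2 + (norm (ip (x - y) ?e))\<^sup>2"
      using whole.Bessel_residual(3)[of "{?e}" "x - y"] c(2) by (simp add: orthonormal_def)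
    moreover have "y + smul (ip (x - y) ?e) ?e \<in> W"
      using subspace_add[OF W(1) yW] subspace_scale[OF W(1)] u by blast
    then have "d \<le> (norm (x - y - smul (ip (x - y) ?e) ?e))\<^sup>2"
      using d[of "y + smul (ip (x - y) ?e) ?e"] by (simp add: diff_diff_eq)
    ultimately have "(norm (ip (x - y) ?e))\<^sup>2 \<le> 0" using min by linarith
    then have "kcnj c * ip (x - y) u = 0" by (simp add: whole.scale_right)
    moreover have "kcnj c \<noteq> 0" using c(1) by simp
    ultimately show ?thesis by simp
  qed
  then show ?thesis using yW by blast
qed

text \<open>Justifies the definite description in \<open>orth_proj\<close>: two candidates differ by
  a vector of \<open>W\<close> that is orthogonal to itself.\<close>

lemma orth_proj_orthogonal:
  assumes W: "subspace W" "closed W" and w: "w \<in> W"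
  shows "ip (x - orth_proj ip W x) w = 0"
proof -
  have "\<exists>!y. y \<in> W \<and> (\<forall>w\<in>W. ip (x - y) w = 0)"
  proof (rule ex_ex1I)
    show "\<exists>y. y \<in> W \<and> (\<forall>w\<in>W. ip (x - y) w = 0)" using projection_exists[OF W] by blast
    fix y z
    assume y: "y \<in> W \<and> (\<forall>w\<in>W. ip (x - y) w = 0)" and z: "z \<in> W \<and> (\<forall>w\<in>W. ip (x - z) w = 0)"
    then have "y - z \<in> W" using subspace_diff[OF W(1)] by blast
    then have "ip (x - z) (y - z) - ip (x - y) (y - z) = 0" using y z by auto
    then have "ip (y - z) (y - z) = 0" by (simp flip: whole.diff_left)
    then show "y = z" by (simp add: ip_self)
  qed
  from theI'[OF this] show ?thesis using w by (simp add: orth_proj_def)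
qed

lemma ip_orth_proj:
  assumes W: "subspace W" "closed W" and w: "w \<in> W"
  shows "ip w x = ip w (orth_proj ip W x)"
proof -
  have "ip w (x - orth_proj ip W x) = 0"
    using orth_proj_orthogonal[OF assms, of x] ip_commute[of w] by simp
  then show ?thesis by (simp add: whole.diff_right)
qed

section \<open>Convergence of the synthesis operator\<close>

text \<open>For a finite partial sum \<open>g\<close>, expand \<open>ip g g\<close> and replace
  \<open>g\<close> by its projections, since \<open>f i\<close> lies in \<open>W i\<close>.
  Cauchy-Schwarz over the indices and the upper frame bound, applied to \<open>g\<close> itself,
  then give the estimate after cancelling \<open>(norm g)\<^sup>2\<close>.\<close>

lemma fusion_frame_summable:
  assumes ff: "fusion_frame smul ip I W v" and f: "f \<in> l2_sum I W"
  shows "(\<lambda>i. v i *\<^sub>R f i) summable_on I"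
proof -
  have W: "subspace (W i)" "closed (W i)" "v i > 0" if "i \<in> I" for i
    using ff that by (auto simp: fusion_frame_def)
  obtain B where summ: "\<And>x. (\<lambda>i. (v i)\<^sup>2 * (norm (orth_proj ip (W i) x))\<^sup>2) summable_on I"
    and B: "\<And>x. (\<Sum>\<^sub>\<infinity>i\<in>I. (v i)\<^sup>2 * (norm (orth_proj ip (W i) x))\<^sup>2) \<le> B * (norm x)\<^sup>2"
    using ff unfolding fusion_frame_def by blast
  have fW: "f i \<in> W i" if "i \<in> I" for i using f that by (auto simp: l2_sum_def)
  have "(norm (\<Sum>i\<in>F. v i *\<^sub>R f i))\<^sup>2 \<le> B * (\<Sum>i\<in>F. (norm (f i))\<^sup>2)"
    if F: "finite F" "F \<subseteq> I" for F
  proof -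
    define g where "g = (\<Sum>i\<in>F. v i *\<^sub>R f i)"
    let ?P = "\<lambda>i. orth_proj ip (W i) g"
    have "ip g g = (\<Sum>i\<in>F. ip (v i *\<^sub>R f i) g)"
      by (subst (1) g_def) (rule whole.sum_left; simp)
    also have "\<dots> = (\<Sum>i\<in>F. of_real (v i) * ip (f i) (?P i))"
    proof (intro sum.cong refl)
      fix i assume "i \<in> F"
      then have i: "i \<in> I" using F by blast
      show "ip (v i *\<^sub>R f i) g = of_real (v i) * ip (f i) (?P i)"
        unfolding ip_orth_proj[OF W(1,2)[OF i] fW[OF i], symmetric]
        by (simp add: ip_scale_left flip: scale_of_real)
    qed
    finally have "(norm g)\<^sup>2 = norm (\<Sum>i\<in>F. of_real (v i) * ip (f i) (?P i))"
      using ip_self[of g] by (metis abs_of_nonneg norm_of_real zero_le_power2)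
    also have "\<dots> \<le> (\<Sum>i\<in>F. \<bar>norm (f i)\<bar> * \<bar>v i * norm (?P i)\<bar>)"
    proof (rule sum_norm_le)
      fix i
      have "\<bar>v i\<bar> * norm (ip (f i) (?P i)) \<le> \<bar>v i\<bar> * (norm (f i) * norm (?P i))"
        by (intro mult_left_mono norm_ip_le) auto
      then show "norm (of_real (v i) * ip (f i) (?P i)) \<le> \<bar>norm (f i)\<bar> * \<bar>v i * norm (?P i)\<bar>"
        by (simp add: norm_mult abs_mult mult_ac)
    qed
    also have "\<dots> \<le> L2_set (\<lambda>i. norm (f i)) F * L2_set (\<lambda>i. v i * norm (?P i)) F"
      by (rule L2_set_mult_ineq)
    finally have "((norm g)\<^sup>2)\<^sup>2 \<le> (L2_set (\<lambda>i. norm (f i)) F * L2_set (\<lambda>i. v i * norm (?P i)) F)\<^sup>2"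
      by (rule power_mono) simp
    also have "\<dots> = (\<Sum>i\<in>F. (norm (f i))\<^sup>2) * (\<Sum>i\<in>F. (v i)\<^sup>2 * (norm (?P i))\<^sup>2)"
      by (simp add: power_mult_distrib L2_set_def sum_nonneg)
    also have "\<dots> \<le> (\<Sum>i\<in>F. (norm (f i))\<^sup>2) * (B * (norm g)\<^sup>2)"
    proof (rule mult_left_mono)
      show "(\<Sum>i\<in>F. (v i)\<^sup>2 * (norm (?P i))\<^sup>2) \<le> B * (norm g)\<^sup>2"
        using finite_sum_le_infsum[OF summ F, of g] B[of g] by simp
    qed (simp add: sum_nonneg)
    finally have *: "(norm g)\<^sup>2 * (norm g)\<^sup>2 \<le> (B * (\<Sum>i\<in>F. (norm (f i))\<^sup>2)) * (norm g)\<^sup>2"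
      by (simp add: mult_ac power2_eq_square)
    \<comment> \<open>Cancellation fails for \<open>g = 0\<close>, where the claim reduces to
      nonnegativity of the right side. The frame inequality at any nonzero vector gives
      \<open>0 \<le> B\<close>; in the zero space every \<open>f i\<close> vanishes.\<close>
    have "0 \<le> B * (\<Sum>i\<in>F. (norm (f i))\<^sup>2)" if "g = 0"
    proof (cases "\<exists>x::'h. x \<noteq> 0")
      case True
      then obtain x :: 'h where "x \<noteq> 0" by blast
      then have "0 < (norm x)\<^sup>2" by simp
      moreover have "0 \<le> (\<Sum>\<^sub>\<infinity>i\<in>I. (v i)\<^sup>2 * (norm (orth_proj ip (W i) x))\<^sup>2)"
        by (intro infsum_nonneg) simp
      then have "0 \<le> B * (norm x)\<^sup>2" using B[of x] by linarith
      ultimately have "0 \<le> B" by (simp add: zero_le_mult_iff)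
      then show ?thesis by (simp add: sum_nonneg)
    next
      case False
      then have "f i = 0" for i by blast
      then show ?thesis by simp
    qed
    moreover have "(norm g)\<^sup>2 \<le> B * (\<Sum>i\<in>F. (norm (f i))\<^sup>2)" if "g \<noteq> 0"
      using * that by (intro mult_right_le_imp_le[OF *]) simp
    ultimately show ?thesis
      unfolding g_def[symmetric] by fastforce
  qed
  moreover have "(\<lambda>i. (norm (f i))\<^sup>2) summable_on I" using f by (simp add: l2_sum_def)
  ultimately show ?thesis
    by (rule summable_on_dominated_square[where g = "\<lambda>i. (norm (f i))\<^sup>2", rotated 2]) simp_all
qed

section \<open>The synthesis kernel as an inner product space\<close>

lemma norm_add_square_le:
  fixes x y :: 'h
  shows "(norm (x + y))\<^sup>2 \<le> 2 * (norm x)\<^sup>2 + 2 * (norm y)\<^sup>2"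
  using parallelogram_law[of x y] zero_le_power2[of "norm (x - y)"] by linarith

lemma norm_smul: "norm (smul c x) = norm c * norm x"
proof -
  have "(norm (smul c x))\<^sup>2 = (norm c * norm x)\<^sup>2"
    using whole.normsq_scale[of x c] by (simp add: power_mult_distrib)
  then show ?thesis by (rule power2_eq_imp_eq) simp_all
qed

text \<open>Cauchy-Schwarz in each component bounds the term by a product of two norms, which is
  dominated by the sum of their squares.\<close>

lemma l2_ip_summable:
  assumes "(\<lambda>i. (norm (f i))\<^sup>2) summable_on I" "(\<lambda>i. (norm (g i))\<^sup>2) summable_on I"
  shows "(\<lambda>i. ip (f i) (g i)) summable_on I"
proof (rule abs_summable_summable, rule summable_on_comparison_test)
  show "(\<lambda>i. (norm (f i))\<^sup>2 + (norm (g i))\<^sup>2) summable_on I"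
    using assms by (rule summable_on_add)
  fix i
  show "norm (ip (f i) (g i)) \<le> (norm (f i))\<^sup>2 + (norm (g i))\<^sup>2"
    using norm_ip_le[of "f i" "g i"] sum_squares_bound[of "norm (f i)" "norm (g i)"]
      mult_nonneg_nonneg[OF norm_ge_zero norm_ge_zero, of "f i" "g i"] by linarith
qed simp

lemma vector_space_pointwise: "vector_space (\<lambda>c (f :: 'i \<Rightarrow> 'h) i. smul c (f i))"
  by unfold_locales
    (simp_all add: fun_eq_iff scale_right_distrib scale_left_distrib)

text \<open>Closure under addition and scaling rests on \<open>fusion_frame_summable\<close>: the
  synthesis sums converge, so \<open>infsum\<close> is linear on them. The laws of
  \<open>l2_ip\<close> follow termwise in the same way from \<open>l2_ip_summable\<close>.\<close>

lemma inner_product_subspace_kernel: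
  assumes ff: "fusion_frame smul ip I W v"
  shows "inner_product_subspace (\<lambda>c f i. smul c (f i)) (l2_ip ip I) (synthesis_kernel I W v)
    (\<lambda>f. \<Sum>\<^sub>\<infinity>i\<in>I. (norm (f i))\<^sup>2)"
proof -
  interpret pw: vector_space "\<lambda>c (f :: _ \<Rightarrow> 'h) i. smul c (f i)"
    by (rule vector_space_pointwise)
  let ?K = "synthesis_kernel I W v"
  have W: "subspace (W i)" if "i \<in> I" for i
    using ff that by (auto simp: fusion_frame_def)
  have sq: "(\<lambda>i. (norm (f i))\<^sup>2) summable_on I" if "f \<in> ?K" for f
    using that by (simp add: synthesis_kernel_def l2_sum_def)
  have summ: "(\<lambda>i. v i *\<^sub>R f i) summable_on I" if "f \<in> ?K" for f
    using that fusion_frame_summable[OF ff] by (simp add: synthesis_kernel_def)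
  have bl: "bounded_linear (smul c)" for c
    by (rule bounded_linear_intro[where K = "norm c"])
      (simp_all add: scale_right_distrib norm_smul mult.commute flip: scale_of_real)
  have add: "f + g \<in> ?K" if f: "f \<in> ?K" and g: "g \<in> ?K" for f g
  proof -
    have "(\<lambda>i. (norm ((f + g) i))\<^sup>2) summable_on I"
    proof (rule summable_on_comparison_test)
      show "(\<lambda>i. 2 * (norm (f i))\<^sup>2 + 2 * (norm (g i))\<^sup>2) summable_on I"
        by (intro summable_on_add summable_on_cmult_right sq f g)
    qed (simp_all add: norm_add_square_le)
    moreover have "synthesis I v (f + g) = synthesis I v f + synthesis I v g"
      unfolding synthesis_def
      by (simp add: scaleR_add_right infsum_add[OF summ[OF f] summ[OF g]])
    ultimately show ?thesis
      using f g W subspace_add by (auto simp: synthesis_kernel_def l2_sum_def)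
  qed
  have scale: "(\<lambda>i. smul c (f i)) \<in> ?K" if f: "f \<in> ?K" for c f
  proof -
    have "(\<lambda>i. (norm (smul c (f i)))\<^sup>2) summable_on I"
      unfolding norm_smul power_mult_distrib by (intro summable_on_cmult_right sq f)
    moreover have "synthesis I v (\<lambda>i. smul c (f i)) = smul c (synthesis I v f)"
      unfolding synthesis_def infsum_bounded_linear[OF bl summ[OF f], symmetric]
      by (simp add: mult.commute flip: scale_of_real)
    ultimately show ?thesis
      using f W subspace_scale by (auto simp: synthesis_kernel_def l2_sum_def)
  qed
  show ?thesis
  proof
    show "pw.subspace ?K"
    proof (rule pw.subspaceI)
      show "0 \<in> ?K"
        using W subspace_0 by (auto simp: synthesis_kernel_def l2_sum_def synthesis_def)
    qed (use add scale in auto)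
  next
    fix f g assume f: "f \<in> ?K" and g: "g \<in> ?K"
    show "l2_ip ip I f g = kcnj (l2_ip ip I g f)"
      unfolding l2_ip_def
        infsum_bounded_linear[OF bounded_linear_kcnj l2_ip_summable[OF sq[OF g] sq[OF f]], symmetric]
      by (subst ip_commute) simp
    show "l2_ip ip I (f + g) h = l2_ip ip I f h + l2_ip ip I g h" if h: "h \<in> ?K" for h
      unfolding l2_ip_def
      by (simp add: ip_add_left infsum_add l2_ip_summable sq f g h)
    show "l2_ip ip I (\<lambda>i. smul c (f i)) g = c * l2_ip ip I f g" for c
      unfolding l2_ip_def using l2_ip_summable[OF sq[OF f] sq[OF g]]
      by (simp add: ip_scale_left infsum_cmult_right)
  next
    fix f assume f: "f \<in> ?K"
    show "l2_ip ip I f f = of_real (\<Sum>\<^sub>\<infinity>i\<in>I. (norm (f i))\<^sup>2)"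
      unfolding l2_ip_def ip_self by (rule infsum_bounded_linear[OF bounded_linear_of_real sq[OF f]])
    show "0 \<le> (\<Sum>\<^sub>\<infinity>i\<in>I. (norm (f i))\<^sup>2)" by (intro infsum_nonneg) simp
    \<comment> \<open>A vanishing sum of nonnegative terms kills the components in \<open>I\<close>;
      outside \<open>I\<close> the extension by zero does.\<close>
    show "f = 0" if 0: "(\<Sum>\<^sub>\<infinity>i\<in>I. (norm (f i))\<^sup>2) = 0"
    proof
      fix i
      show "f i = 0 i"
      proof (cases "i \<in> I")
        case True
        then have "(norm (f i))\<^sup>2 = 0"
          using nonneg_infsum_le_0D[OF _ sq[OF f]] 0 by simp
        then show ?thesis by simp
      next
        case False
        then show ?thesis using f by (simp add: synthesis_kernel_def l2_sum_def)
      qed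
    qed
  qed
qed

section \<open>Unitary operators and invariance of the excess\<close>

lemma unitary_norm:
  assumes "unitary smul ip U"
  shows "norm (U x) = norm x"
proof -
  have "(of_real ((norm (U x))\<^sup>2) :: 'k) = of_real ((norm x)\<^sup>2)"
    using assms unfolding ip_self[symmetric] by (simp add: unitary_def)
  then have "(norm (U x))\<^sup>2 = (norm x)\<^sup>2" unfolding of_real_eq_iff .
  then show ?thesis by (rule power2_eq_imp_eq) simp_all
qed

text \<open>Being isometric, \<open>U\<close> preserves square-summability and is continuous, so it
  commutes with the synthesis sum; injectivity of \<open>U\<close> then matches the two
  kernels.\<close>

lemma kernel_unitary_image:
  assumes U: "unitary smul ip U" and WV: "\<And>i. i \<in> I \<Longrightarrow> W i = U ` V i"
    and ff: "fusion_frame smul ip I V v"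
  defines "\<phi> \<equiv> \<lambda>f i. if i \<in> I then U (f i) else 0"
  shows "bij_betw \<phi> (synthesis_kernel I V v) (synthesis_kernel I W v)"
    and "\<And>f g. l2_ip ip I (\<phi> f) (\<phi> g) = l2_ip ip I f g"
proof -
  interpret U: Vector_Spaces.linear smul smul U using U by (simp add: unitary_def)
  have blU: "bounded_linear U"
    by (rule bounded_linear_intro[where K = 1])
      (simp_all add: U.add unitary_norm[OF U] U.scale flip: scale_of_real)
  have injU: "U x = U y \<longleftrightarrow> x = y" for x y
    using unitary_norm[OF U, of "x - y"] by (auto simp: U.diff)
  have norm: "(\<lambda>i. (norm (\<phi> f i))\<^sup>2) summable_on I \<longleftrightarrow> (\<lambda>i. (norm (f i))\<^sup>2) summable_on I" for f
    by (intro summable_on_cong) (simp add: \<phi>_def unitary_norm[OF U])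
  have synth: "synthesis I v (\<phi> f) = 0 \<longleftrightarrow> synthesis I v f = 0" if f: "f \<in> l2_sum I V" for f
  proof -
    have "synthesis I v (\<phi> f) = (\<Sum>\<^sub>\<infinity>i\<in>I. U (v i *\<^sub>R f i))"
      unfolding synthesis_def by (intro infsum_cong) (simp add: \<phi>_def U.scale flip: scale_of_real)
    also have "\<dots> = U (synthesis I v f)"
      unfolding synthesis_def by (rule infsum_bounded_linear[OF blU fusion_frame_summable[OF ff f]])
    finally show ?thesis using injU[of _ 0] by (simp add: U.zero)
  qed
  \<comment> \<open>Since \<phi> overwrites all values outside \<open>I\<close> by zero, membership
    of the image can be reflected back only for families that vanish there.\<close>
  have l2: "\<phi> f \<in> l2_sum I W \<longleftrightarrow> f \<in> l2_sum I V" if "\<And>i. i \<notin> I \<Longrightarrow> f i = 0" for f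
  proof -
    have "\<phi> f i \<in> W i \<longleftrightarrow> f i \<in> V i" if "i \<in> I" for i
      using that by (auto simp: \<phi>_def WV injU)
    then show ?thesis using that norm[of f] by (simp add: l2_sum_def) (simp add: \<phi>_def)
  qed
  show "bij_betw \<phi> (synthesis_kernel I V v) (synthesis_kernel I W v)"
    unfolding bij_betw_def
  proof (intro conjI equalityI subsetI)
    show "inj_on \<phi> (synthesis_kernel I V v)"
    proof (rule inj_onI, rule ext)
      fix f g i
      assume fg: "f \<in> synthesis_kernel I V v" "g \<in> synthesis_kernel I V v" and eq: "\<phi> f = \<phi> g"
      show "f i = g i"
        using fg fun_cong[OF eq, of i] injU
        by (cases "i \<in> I") (simp_all add: synthesis_kernel_def l2_sum_def \<phi>_def)
    qed
  next
    fix h assume "h \<in> \<phi> ` synthesis_kernel I V v"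
    then obtain f where f: "f \<in> l2_sum I V" "synthesis I v f = 0" and h: "h = \<phi> f"
      by (auto simp: synthesis_kernel_def)
    then show "h \<in> synthesis_kernel I W v"
      using l2[of f] synth[of f] by (simp add: synthesis_kernel_def l2_sum_def)
  next
    fix h assume h: "h \<in> synthesis_kernel I W v"
    define f where "f i = (if i \<in> I then inv U (h i) else 0)" for i
    have "surj U" using U by (simp add: unitary_def)
    then have \<phi>f: "\<phi> f = h"
      using h by (auto simp: \<phi>_def f_def fun_eq_iff surj_f_inv_f synthesis_kernel_def l2_sum_def)
    have "f \<in> l2_sum I V"
      using l2[of f] h by (simp add: \<phi>f synthesis_kernel_def) (simp add: f_def)
    then have "f \<in> synthesis_kernel I V v"
      using synth[of f] h by (simp add: \<phi>f synthesis_kernel_def)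
    then show "h \<in> \<phi> ` synthesis_kernel I V v" using \<phi>f by blast
  qed
  show "l2_ip ip I (\<phi> f) (\<phi> g) = l2_ip ip I f g" for f g
    unfolding l2_ip_def using U by (intro infsum_cong) (simp add: \<phi>_def unitary_def)
qed

text \<open>The two bases picked by \<open>SOME\<close> are unrelated: the one for \<open>V\<close>
  is first carried over by \<phi>, then compared with the one for \<open>W\<close> inside the same
  kernel. Injectivity of \<phi> keeps the cardinality.\<close>

lemma excess_unitary_equivalent:
  assumes ffW: "fusion_frame smul ip I W v" and ffV: "fusion_frame smul ip I V v"
    and "unitary_equivalent smul ip I W V"
  shows "excess ip I W v =o excess ip I V v"
proof -
  obtain U where U: "unitary smul ip U" and WV: "\<And>i. i \<in> I \<Longrightarrow> W i = U ` V i"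
    using assms(3) by (auto simp: unitary_equivalent_def)
  define \<phi> where "\<phi> = (\<lambda>f i. if i \<in> I then U (f i) else 0)"
  let ?KW = "synthesis_kernel I W v" and ?KV = "synthesis_kernel I V v"
  let ?basis = "orthonormal_basis (l2_ip ip I)"
  interpret KW: inner_product_subspace "\<lambda>c f i. smul c (f i)" "l2_ip ip I" ?KW
      "\<lambda>f. \<Sum>\<^sub>\<infinity>i\<in>I. (norm (f i))\<^sup>2"
    by (rule inner_product_subspace_kernel[OF ffW])
  have bij: "bij_betw \<phi> ?KV ?KW" and ip: "\<And>f g. l2_ip ip I (\<phi> f) (\<phi> g) = l2_ip ip I f g"
    using kernel_unitary_image[OF U WV ffV] by (simp_all add: \<phi>_def)
  have to_W: "?basis ?KW (\<phi> ` B)" if "?basis ?KV B" for B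
    using orthonormal_basis_image[OF bij ip that] .
  \<comment> \<open>The reverse transport shows that a kernel without a basis on the
    \<open>V\<close> side forces the same on the \<open>W\<close> side.\<close>
  have to_V: "?basis ?KV (inv_into ?KV \<phi> ` C)" if "?basis ?KW C" for C
  proof (rule orthonormal_basis_image[OF bij_betw_inv_into[OF bij] _ that])
    fix f g assume "f \<in> ?KW" "g \<in> ?KW"
    then show "l2_ip ip I (inv_into ?KV \<phi> f) (inv_into ?KV \<phi> g) = l2_ip ip I f g"
      using ip[of "inv_into ?KV \<phi> f" "inv_into ?KV \<phi> g"] bij
      by (simp add: bij_betw_inv_into_right)
  qed
  show ?thesis
  proof (cases "\<exists>B. ?basis ?KV B")
    case True
    define B where "B = (SOME B. ?basis ?KV B)"
    define C where "C = (SOME C. ?basis ?KW C)"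
    have B: "?basis ?KV B" using True unfolding B_def by (rule someI_ex)
    have C: "?basis ?KW C" using to_W[OF B] unfolding C_def by (rule someI)
    have "|C| =o |\<phi> ` B|" by (rule KW.orthonormal_basis_card_eq[OF C to_W[OF B]])
    moreover have "inj_on \<phi> B"
      using B bij by (auto simp: orthonormal_basis_def bij_betw_def intro: inj_on_subset)
    then have "|\<phi> ` B| =o |B|"
      using card_of_ordIso[of B "\<phi> ` B"] by (auto simp: bij_betw_def intro: ordIso_symmetric)
    ultimately show ?thesis
      unfolding excess_def hilbert_dim_def B_def[symmetric] C_def[symmetric]
      by (rule ordIso_transitive)
  next
    case False
    \<comment> \<open>If there were no basis at all, both \<open>SOME\<close> would range over the empty predicate and
      coincide; this makes an appeal to Zorn's lemma unnecessary.\<close>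
    then have "?basis ?KW = ?basis ?KV" using to_V by (intro ext) blast
    then show ?thesis unfolding excess_def hilbert_dim_def by (simp add: card_of_refl)
  qed
qed

end

theorem proposition5p4:
  fixes smul :: "'k::rc_field \<Rightarrow> 'h::banach \<Rightarrow> 'h"
    and ip :: "'h \<Rightarrow> 'h \<Rightarrow> 'k"
    and I :: "'i set"
    and W V :: "'i \<Rightarrow> 'h set"
    and v :: "'i \<Rightarrow> real"
  assumes "hilbert_space smul ip"
    and "fusion_frame smul ip I W v"
    and "fusion_frame smul ip I V v"
    and "unitary_equivalent smul ip I W V"
  shows "excess ip I W v =o excess ip I V v"
  using assms(2-4) by (rule hilbert_space.excess_unitary_equivalent[OF assms(1)])

end
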